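(* Let $h\in\mathbb Z_{++}$, let $X\subseteq\{0,1\}^n$ with $\|\mathbf x\|_1=h$ for every $\mathbf x\in X$, and let $\ell(\mathbf x,\mathbf c)=\mathbf c^\top\mathbf x$. Let $\mathcal S_0=\{\mathbf c'\in\mathbb R^n:\mathbf 0\le\mathbf c'\le\mathbf 1\}$ and, for given decisions $\mathbf x^{(k)}\in X$ and observed total costs $S^{(k)}\in\mathbb R_+$, $k\in\mathcal K$, let $$\mathcal S_k=\{\mathbf c'\in\mathbb R^n:\ \mathbf c'^\top\mathbf x^{(k)}=S^{(k)}\}\cap\mathcal S_0 .$$ Assume that the decisions $\mathbf x^{(k)}$, $k\in\mathcal K$, are comprised of $V$ mutually non-overlapping decisions $\widetilde{\mathbf x}^{(v)}$, $v\in\{1,\dots,V\}$, where the total cost of each $\widetilde{\mathbf x}^{(v)}$ is observed $n_v\ge1$ times, $\sum_{v=1}^V n_v=K$. Let $\overline S_v$ be the empirical mean of the observed total costs of $\widetilde{\mathbf x}^{(v)}$. Then the optimal objective function value of the three-level problem $$\min_{\mathbf{x} \in X}\ \max_{\widehat{\mathbf{C}}} \Big\{ \max_{\mathbb{Q} \in \mathcal{Q}(\widehat{\mathbf{C}})} \mathbb{E}_{\mathbb{Q}} \{\ell(\mathbf{x}, \mathbf{c})\}:\ \hat{\mathbf{c}}^{(k)} \in \mathcal{S}_k \ \ \forall k \in \mathcal{K} \Big\}$$ equals $$\min \Big\{ \frac{1}{K} \min_{v \in \{1, \ldots, V\}}\big\{ n_v \overline{S}_v + (K - n_v)h\big \}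 + \varepsilon_K;\ h\Big\},$$ and an optimal decision is $\mathbf x^*=\widetilde{\mathbf x}^{(v^* )}$, where $v^*\in\operatorname{argmin}_{v \in \{1, \ldots, V\}}\{ n_v \overline{S}_v + (K - n_v)h\}$.
   Context: $K\ge1$ is an integer, $\mathcal K=\{1,\dots,K\}$, $\mathcal A=\{1,\dots,n\}$; vector inequalities are component-wise and $\mathbf 1$ is the all-ones vector. The sets $\mathcal S_k$ are assumed nonempty (equivalently, $S^{(k)}\in[0,h]$). Non-overlapping decisions: $\mathbf x',\mathbf x''\in X$ are called non-overlapping if $x'_a+x''_a\in\{0,1\}$ for each $a\in\mathcal A$. "Comprised of $V$ mutually non-overlapping decisions, each observed $n_v$ times" means: $\widetilde{\mathbf x}^{(v)}\in X$ and $\widetilde{\mathbf x}^{(v')}\in X$ are non-overlapping for $v\ne v'$, each $\mathbf x^{(k)}$ equals some $\widetilde{\mathbf x}^{(v)}$, and $n_v=|\{k\in\mathcal K:\mathbf x^{(k)}=\widetilde{\mathbf x}^{(v)}\}|$. Accordingly $\overline S_v=\frac1{n_v}\sum_{k:\,\mathbf x^{(k)}=\widetilde{\mathbf x}^{(v)}}S^{(k)}$. Data set: $\widehat{\mathbf C}=(\hat{\mathbf c}^{(1)},\dots,\hat{\mathbf c}^{(K)})$ with $\hat{\mathbf c}^{(k)}\in\mathbb R^n$; its empirical distribution is $\widehat{\mathbb Q}_K=\frac1K\sum_{k=1}^K\delta_{\hat{\mathbf c}^{(k)}}$, where $\delta_{\mathbf z}$ is the Dirac point mass at $\mathbf z$.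 Ambiguity set: $\mathcal Q_0(\mathcal S_0)$ is the set of probability distributions supported on $\mathcal S_0$. The type-1 Wasserstein distance with respect to the $l_1$-norm is $$W^1(\mathbb Q,\mathbb Q')=\inf_{\pi\in\Pi(\mathbb Q,\mathbb Q')}\int_{\mathcal S_0\times\mathcal S_0}\|\mathbf c-\mathbf c'\|_1\,\pi(\mathrm d\mathbf c,\mathrm d\mathbf c'),$$ where $\Pi(\mathbb Q,\mathbb Q')$ is the set of joint distributions on $\mathcal S_0\times\mathcal S_0$ with marginals $\mathbb Q$ and $\mathbb Q'$. For a given radius $\varepsilon_K>0$, $$\mathcal Q(\widehat{\mathbf C})=\{\mathbb Q\in\mathcal Q_0(\mathcal S_0):\ W^1(\widehat{\mathbb Q}_K,\mathbb Q)\le\varepsilon_K\}.$$ *)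

theory Defs
  imports "HOL-Probability.Probability"
begin

definition l1_norm :: "real ^ 'n \<Rightarrow> real" where
  "l1_norm c = (\<Sum>a\<in>UNIV. \<bar>c $ a\<bar>)"

definition cost_support :: "(real ^ 'n) set" where
  "cost_support = {c. \<forall>a. 0 \<le> c $ a \<and> c $ a \<le> 1}"

definition observation_set :: "real ^ 'n \<Rightarrow> real \<Rightarrow> (real ^ 'n) set" where
  "observation_set x s = {c. c \<bullet> x = s} \<inter> cost_support"

definition non_overlapping :: "real ^ 'n \<Rightarrow> real ^ 'n \<Rightarrow> bool" where
  "non_overlapping x x' \<longleftrightarrow> (\<forall>a. x $ a + x' $ a \<in> {0, 1})"

definition loss :: "real ^ 'n \<Rightarrow> real ^ 'n \<Rightarrow> real" where
  "loss x c = c \<bullet> x"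

text \<open>Distributions supported on a set are Borel probability measures on the whole space
  that give this set full mass.\<close>

definition distributions_on :: "(real ^ 'n) set \<Rightarrow> (real ^ 'n) measure set" where
  "distributions_on S = {Q. prob_space Q \<and> sets Q = sets borel \<and> emeasure Q S = 1}"

definition couplings ::
  "(real ^ 'n) set \<Rightarrow> (real ^ 'n) measure \<Rightarrow> (real ^ 'n) measure
    \<Rightarrow> ((real ^ 'n) \<times> (real ^ 'n)) measure set" where
  "couplings S P Q =
    {\<pi>. prob_space \<pi> \<and> sets \<pi> = sets (borel \<Otimes>\<^sub>M borel) \<and> emeasure \<pi> (S \<times> S) = 1 \<and>
        distr \<pi> borel fst = P \<and> distr \<pi> borel snd = Q}"

definition wasserstein1 ::
  "(real ^ 'n) set \<Rightarrow> (real ^ 'n) measure \<Rightarrow> (real ^ 'n) measure \<Rightarrow> ennreal" where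
  "wasserstein1 S P Q =
    (INF \<pi>\<in>couplings S P Q. \<integral>\<^sup>+p\<in>S \<times> S. ennreal (l1_norm (fst p - snd p)) \<partial>\<pi>)"

definition empirical_distribution :: "nat \<Rightarrow> (nat \<Rightarrow> real ^ 'n) \<Rightarrow> (real ^ 'n) measure" where
  "empirical_distribution K C =
    measure_of UNIV (sets borel)
      (\<lambda>A. ennreal (1 / real K) * (\<Sum>k\<in>{1..K}. emeasure (return borel (C k)) A))"

lemma sets_empirical_distribution [simp]:
  "sets (empirical_distribution K C) = sets borel"
  unfolding empirical_distribution_def
  by (metis sets.sets_measure_of_eq space_borel)

lemma emeasure_empirical_distribution:
  fixes C :: "nat \<Rightarrow> real ^ 'n"
  assumes "A \<in> sets borel"
  shows "emeasure (empirical_distribution K C) A =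
    ennreal (1 / real K) * (\<Sum>k\<in>{1..K}. emeasure (return borel (C k)) A)"
proof -
  let ?\<mu> = "\<lambda>A. ennreal (1 / real K) * (\<Sum>k\<in>{1..K}. emeasure (return borel (C k)) A)"
  have "countably_additive (sets (borel :: (real ^ 'n) measure)) ?\<mu>"
  proof (rule countably_additiveI)
    fix B :: "nat \<Rightarrow> (real ^ 'n) set"
    assume B: "range B \<subseteq> sets borel" "disjoint_family B"
    have "(\<Sum>i. ?\<mu> (B i)) =
        ennreal (1 / real K) * (\<Sum>k\<in>{1..K}. \<Sum>i. emeasure (return borel (C k)) (B i))"
      by (subst suminf_sum[symmetric]) auto
    also have "\<dots> = ?\<mu> (\<Union>i. B i)"
      using B by (subst suminf_emeasure) auto
    finally show "(\<Sum>i. ?\<mu> (B i)) = ?\<mu> (\<Union>i. B i)" .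
  qed
  then show ?thesis
    using assms unfolding empirical_distribution_def
    by (intro emeasure_measure_of_sigma)
       (auto simp: positive_def sets.sigma_algebra_axioms[of borel, simplified])
qed

definition ambiguity_set ::
  "nat \<Rightarrow> real \<Rightarrow> (nat \<Rightarrow> real ^ 'n) \<Rightarrow> (real ^ 'n) measure set" where
  "ambiguity_set K \<epsilon> C =
    {Q \<in> distributions_on cost_support.
      wasserstein1 cost_support (empirical_distribution K C) Q \<le> ennreal \<epsilon>}"

definition feasible_data ::
  "nat \<Rightarrow> (nat \<Rightarrow> real ^ 'n) \<Rightarrow> (nat \<Rightarrow> real) \<Rightarrow> (nat \<Rightarrow> real ^ 'n) set" where
  "feasible_data K xobs S = (\<Pi>\<^sub>E k\<in>{1..K}. observation_set (xobs k) (S k))"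

definition expected_loss :: "real ^ 'n \<Rightarrow> (real ^ 'n) measure \<Rightarrow> real" where
  "expected_loss x Q = (\<integral>c. loss x c \<partial>Q)"

text \<open>Maxima over infinite sets are written as real suprema; that they are attained, and hence
  genuine maxima, has to be stated separately where it matters.\<close>

definition worst_case_expectation ::
  "nat \<Rightarrow> real \<Rightarrow> real ^ 'n \<Rightarrow> (nat \<Rightarrow> real ^ 'n) \<Rightarrow> real" where
  "worst_case_expectation K \<epsilon> x C = (SUP Q\<in>ambiguity_set K \<epsilon> C. expected_loss x Q)"

definition worst_case_data_value ::
  "nat \<Rightarrow> real \<Rightarrow> (nat \<Rightarrow> real ^ 'n) \<Rightarrow> (nat \<Rightarrow> real) \<Rightarrow> real ^ 'n \<Rightarrow> real" where
  "worst_case_data_value K \<epsilon> xobs S x =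
    (SUP C\<in>feasible_data K xobs S. worst_case_expectation K \<epsilon> x C)"

end

(* For fixed data C the worst-case expectation is min (mean of C k \<bullet> x + \<epsilon>) h.  The upper bound is
   Kantorovich's: the loss is 1-Lipschitz in the l1-norm and bounded by h.

   Given a decision xt v, the adversary cannot change the loss of the n_v observations of xt v, and
   all other observations lose at most h; this bounds the value of xt v from above.  For the lower
   bound at an arbitrary x, no optimal data is computed: data spreading S k evenly over the support
   of xobs k, with cost 1 elsewhere, is feasible, does not depend on x, and already costs every x
   at least the minimum over v, since the overlaps of x with the xt v sum to at most h. *)

theory Submission
  imports Defs
begin

section \<open>The cost box and binary decisions\<close>

lemma cost_support_eq_cbox: "(cost_support :: (real ^ 'n) set) = cbox (vec 0) (vec 1)"
  by (auto simp: cost_support_def mem_box_cart)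

lemma compact_cost_support: "compact (cost_support :: (real ^ 'n) set)"
  by (simp add: cost_support_eq_cbox compact_cbox)

lemma cost_support_borel [measurable]: "(cost_support :: (real ^ 'n) set) \<in> sets borel"
  by (simp add: cost_support_eq_cbox)

text \<open>Compactness is what lets a linear loss attain its maximum over the cost vectors
  consistent with one observation.\<close>

lemma compact_observation_set: "compact (observation_set x s)"
proof -
  have "closed {c. c \<bullet> x = s}"
    by (intro closed_Collect_eq continuous_intros)
  then show ?thesis
    by (simp add: observation_set_def closed_Int_compact compact_cost_support)
qed

lemma l1_norm_measurable [measurable]: "(l1_norm :: real ^ 'n \<Rightarrow> real) \<in> borel_measurable borel"
  unfolding l1_norm_def
  by (intro borel_measurable_continuous_onI continuous_intros)

lemma loss_measurable [measurable]: "loss x \<in> borel_measurable borel"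
  unfolding loss_def by measurable

lemma binary_nonneg_le_one:
  fixes x :: "real ^ 'n"
  assumes "\<And>a. x $ a \<in> {0, 1}"
  shows "0 \<le> x $ a" "x $ a \<le> 1"
  using assms[of a] by auto

lemma l1_norm_binary:
  fixes x :: "real ^ 'n"
  assumes "\<And>a. x $ a \<in> {0, 1}"
  shows "l1_norm x = (\<Sum>a\<in>UNIV. x $ a)"
  using binary_nonneg_le_one[OF assms] by (simp add: l1_norm_def)

lemma inner_binary_self:
  fixes x :: "real ^ 'n"
  assumes "\<And>a. x $ a \<in> {0, 1}"
  shows "x \<bullet> x = l1_norm x"
proof -
  have "x $ a * x $ a = x $ a" for a
    using assms[of a] by auto
  then show ?thesis
    unfolding inner_vec_def inner_real_def l1_norm_binary[OF assms] by (intro sum.cong) auto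
qed

lemma one_inner_binary:
  fixes x :: "real ^ 'n"
  assumes "\<And>a. x $ a \<in> {0, 1}"
  shows "1 \<bullet> x = l1_norm x"
  using assms by (simp add: inner_vec_def l1_norm_binary)

text \<open>The entries of \<open>x\<close> have absolute value at most 1, so the pairing cannot
  exceed the l1-norm. Applied to a difference of two cost vectors, this is the 1-Lipschitz property
  of the loss.\<close>

lemma inner_le_l1_norm:
  fixes x d :: "real ^ 'n"
  assumes "\<And>a. x $ a \<in> {0, 1}"
  shows "\<bar>d \<bullet> x\<bar> \<le> l1_norm d"
proof -
  have "\<bar>d \<bullet> x\<bar> \<le> (\<Sum>a\<in>UNIV. \<bar>d $ a * x $ a\<bar>)"
    unfolding inner_vec_def inner_real_def by (rule sum_abs)
  also have "\<dots> \<le> (\<Sum>a\<in>UNIV. \<bar>d $ a\<bar>)"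
  proof (rule sum_mono)
    show "\<bar>d $ a * x $ a\<bar> \<le> \<bar>d $ a\<bar>" for a
      using assms[of a] by auto
  qed
  finally show ?thesis
    by (simp add: l1_norm_def)
qed

lemma cost_support_inner_bounds:
  fixes x c :: "real ^ 'n"
  assumes "\<And>a. x $ a \<in> {0, 1}" "c \<in> cost_support"
  shows "0 \<le> c \<bullet> x" "c \<bullet> x \<le> l1_norm x"
proof -
  have "0 \<le> c $ a" "c $ a \<le> 1" for a
    using assms(2) by (auto simp: cost_support_def)
  note * = this binary_nonneg_le_one[OF assms(1)]
  show "0 \<le> c \<bullet> x"
    unfolding inner_vec_def inner_real_def by (intro sum_nonneg mult_nonneg_nonneg *)
  show "c \<bullet> x \<le> l1_norm x"
    unfolding l1_norm_binary[OF assms(1)] inner_vec_def inner_real_def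
    by (intro sum_mono mult_left_le_one_le *)
qed

text \<open>A crude bound that serves to make the transport cost integrable under every
  coupling.\<close>

lemma l1_norm_diff_cost_support:
  fixes c c' :: "real ^ 'n"
  assumes "c \<in> cost_support" "c' \<in> cost_support"
  shows "l1_norm (c - c') \<le> real CARD('n)"
proof -
  have "\<bar>c $ a - c' $ a\<bar> \<le> 1" for a
  proof -
    have "0 \<le> c $ a" "c $ a \<le> 1" "0 \<le> c' $ a" "c' $ a \<le> 1"
      using assms by (auto simp: cost_support_def)
    then show ?thesis by linarith
  qed
  then have "l1_norm (c - c') \<le> (\<Sum>a\<in>(UNIV :: 'n set). 1)"
    unfolding l1_norm_def by (intro sum_mono) simp
  then show ?thesis by simp
qed

section \<open>Expectations over the cost box and the Kantorovich bound\<close>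

lemma distributions_on_AE:
  assumes "Q \<in> distributions_on cost_support"
  shows "AE c in Q. c \<in> cost_support"
proof -
  interpret prob_space Q
    using assms by (simp add: distributions_on_def)
  have "cost_support \<in> sets Q" "prob cost_support = 1"
    using assms by (auto simp: distributions_on_def measure_def)
  then show ?thesis
    using AE_in_set_eq_1 by blast
qed

lemma expected_loss_le_l1_norm:
  fixes x :: "real ^ 'n"
  assumes "\<And>a. x $ a \<in> {0, 1}" "Q \<in> distributions_on cost_support"
  shows "expected_loss x Q \<le> l1_norm x"
proof -
  interpret prob_space Q
    using assms(2) by (simp add: distributions_on_def)
  have [measurable_cong]: "sets Q = sets borel"
    using assms(2) by (simp add: distributions_on_def)
  have "AE c in Q. norm (loss x c) \<le> l1_norm x"
    using distributions_on_AE[OF assms(2)]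
    by eventually_elim (use cost_support_inner_bounds[OF assms(1)] in \<open>simp add: loss_def\<close>)
  moreover have "loss x \<in> borel_measurable Q"
    by measurable
  ultimately have "integrable Q (loss x)"
    by (rule integrable_const_bound)
  moreover have "AE c in Q. loss x c \<le> l1_norm x"
    using distributions_on_AE[OF assms(2)]
    by eventually_elim (use cost_support_inner_bounds[OF assms(1)] in \<open>simp add: loss_def\<close>)
  ultimately show ?thesis
    unfolding expected_loss_def by (rule integral_le_const)
qed

text \<open>The easy half of Kantorovich duality: under any coupling the difference of the
  expectations is the mean of a difference of losses, which the transport cost dominates pointwise.
  A negative difference is truncated to 0 by \<open>ennreal\<close>, and with no coupling at all the
  infimum is infinite, so both cases are harmless.\<close>

lemma expected_loss_diff_le_wasserstein1:
  fixes x :: "real ^ 'n"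
  assumes "\<And>a. x $ a \<in> {0, 1}"
  shows "ennreal (expected_loss x Q - expected_loss x P) \<le> wasserstein1 cost_support P Q"
  unfolding wasserstein1_def
proof (rule INF_greatest)
  fix \<pi> :: "((real ^ 'n) \<times> (real ^ 'n)) measure"
  assume \<pi>: "\<pi> \<in> couplings cost_support P Q"
  let ?S = "cost_support \<times> cost_support :: ((real ^ 'n) \<times> (real ^ 'n)) set"
  \<comment> \<open>The indicator keeps this real version of the transport cost bounded everywhere,
    so that its Bochner and Lebesgue integrals can be identified.\<close>
  let ?d = "\<lambda>p. l1_norm (fst p - snd p) * indicator ?S p"
  interpret prob_space \<pi>
    using \<pi> by (simp add: couplings_def)
  have [measurable_cong]: "sets \<pi> = sets (borel \<Otimes>\<^sub>M borel)"
    using \<pi> by (simp add: couplings_def)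
  have marginals: "P = distr \<pi> borel fst" "Q = distr \<pi> borel snd"
    using \<pi> by (auto simp: couplings_def)
  have S [measurable]: "?S \<in> sets \<pi>" by measurable
  moreover have "prob ?S = 1"
    using \<pi> by (simp add: couplings_def measure_def)
  ultimately have ae: "AE p in \<pi>. p \<in> ?S"
    using AE_in_set_eq_1 by blast
  have int1: "integrable \<pi> (\<lambda>p. loss x (fst p))"
  proof (rule integrable_const_bound)
    show "AE p in \<pi>. norm (loss x (fst p)) \<le> l1_norm x"
      using ae by eventually_elim
        (use cost_support_inner_bounds[OF assms] in \<open>auto simp: loss_def\<close>)
  qed measurable
  have int2: "integrable \<pi> (\<lambda>p. loss x (snd p))"
  proof (rule integrable_const_bound)
    show "AE p in \<pi>. norm (loss x (snd p)) \<le> l1_norm x"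
      using ae by eventually_elim
        (use cost_support_inner_bounds[OF assms] in \<open>auto simp: loss_def\<close>)
  qed measurable
  have nonneg: "0 \<le> ?d p" for p
    by (simp add: l1_norm_def sum_nonneg)
  have intd: "integrable \<pi> ?d"
  proof (rule integrable_const_bound)
    show "AE p in \<pi>. norm (?d p) \<le> real CARD('n)"
      using nonneg l1_norm_diff_cost_support by (intro AE_I2) (auto simp: indicator_def)
  qed measurable
  have "expected_loss x Q - expected_loss x P = (\<integral>p. loss x (snd p) - loss x (fst p) \<partial>\<pi>)"
    by (simp add: expected_loss_def marginals integral_distr int1 int2)
  also have "\<dots> \<le> integral\<^sup>L \<pi> ?d"
  proof (rule integral_mono_AE)
    show "AE p in \<pi>. loss x (snd p) - loss x (fst p) \<le> ?d p"
      using ae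
    proof eventually_elim
      case (elim p)
      then show ?case
        using inner_le_l1_norm[OF assms, of "fst p - snd p"]
        by (simp add: loss_def inner_diff_left)
    qed
  qed (use int1 int2 intd in auto)
  finally have "ennreal (expected_loss x Q - expected_loss x P) \<le> ennreal (integral\<^sup>L \<pi> ?d)"
    by (rule ennreal_leI)
  also have "\<dots> = (\<integral>\<^sup>+p. ennreal (?d p) \<partial>\<pi>)"
    using intd nonneg by (simp add: nn_integral_eq_integral)
  also have "\<dots> = (\<integral>\<^sup>+p\<in>?S. ennreal (l1_norm (fst p - snd p)) \<partial>\<pi>)"
    by (intro nn_integral_cong) (auto simp: indicator_def)
  finally show "ennreal (expected_loss x Q - expected_loss x P)
    \<le> (\<integral>\<^sup>+p\<in>?S. ennreal (l1_norm (fst p - snd p)) \<partial>\<pi>)" .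
qed

section \<open>Transport between empirical distributions and the worst case for fixed data\<close>

text \<open>As an image of the uniform distribution on the indices, the empirical distribution turns
  integrals into finite averages, and two data sets are coupled simply by sharing the index.\<close>

lemma empirical_distribution_eq_distr:
  fixes C :: "nat \<Rightarrow> real ^ 'n"
  assumes "K \<ge> 1"
  shows "empirical_distribution K C = distr (measure_pmf (pmf_of_set {1..K})) borel C"
proof (rule measure_eqI)
  fix A assume "A \<in> sets (empirical_distribution K C)"
  then have A: "A \<in> sets borel" by simp
  have "(\<Sum>k\<in>{1..K}. emeasure (return borel (C k)) A) = of_nat (card {k \<in> {1..K}. C k \<in> A})"
    using A by (simp add: indicator_def sum.If_cases Int_def)
  moreover have "emeasure (distr (measure_pmf (pmf_of_set {1..K})) borel C) A
      = ennreal (real (card {k \<in> {1..K}. C k \<in> A}) / real K)"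
    using A assms
    by (simp add: emeasure_distr emeasure_pmf_of_set Int_def vimage_def)
  ultimately show "emeasure (empirical_distribution K C) A
      = emeasure (distr (measure_pmf (pmf_of_set {1..K})) borel C) A"
    using assms A
    by (simp add: emeasure_empirical_distribution ennreal_of_nat_eq_real_of_nat
        ennreal_mult'[symmetric] del: ennreal_1)
qed simp

lemma expected_loss_empirical:
  assumes "K \<ge> 1"
  shows "expected_loss x (empirical_distribution K C) = (\<Sum>k\<in>{1..K}. C k \<bullet> x) / real K"
  unfolding expected_loss_def empirical_distribution_eq_distr[OF assms]
  using assms by (subst integral_distr) (auto simp: integral_pmf_of_set loss_def)

lemma empirical_in_distributions_on:
  assumes "K \<ge> 1" "\<And>k. k \<in> {1..K} \<Longrightarrow> C k \<in> cost_support"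
  shows "empirical_distribution K C \<in> distributions_on cost_support"
proof -
  have "prob_space (empirical_distribution K C)"
    unfolding empirical_distribution_eq_distr[OF assms(1)]
    by (rule prob_space.prob_space_distr) (auto intro: measure_pmf.prob_space_axioms)
  moreover have "emeasure (empirical_distribution K C) cost_support = 1"
  proof -
    have "emeasure (empirical_distribution K C) cost_support
        = emeasure (measure_pmf (pmf_of_set {1..K})) (C -` cost_support)"
      by (simp add: empirical_distribution_eq_distr[OF assms(1)] emeasure_distr)
    also have "\<dots> = 1"
      using assms by (intro measure_pmf.emeasure_eq_1_AE) (auto simp: AE_measure_pmf_iff)
    finally show ?thesis .
  qed
  ultimately show ?thesis
    by (simp add: distributions_on_def)
qed

text \<open>Sending the mass at \<open>C k\<close> to \<open>D k\<close> for every \<open>k\<close>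
  is one admissible coupling, and its mean cost bounds the infimum.\<close>

lemma wasserstein1_empirical_le:
  fixes C D :: "nat \<Rightarrow> real ^ 'n"
  assumes "K \<ge> 1"
    and "\<And>k. k \<in> {1..K} \<Longrightarrow> C k \<in> cost_support" "\<And>k. k \<in> {1..K} \<Longrightarrow> D k \<in> cost_support"
  shows "wasserstein1 cost_support (empirical_distribution K C) (empirical_distribution K D)
    \<le> ennreal ((\<Sum>k\<in>{1..K}. l1_norm (C k - D k)) / real K)"
proof -
  let ?U = "measure_pmf (pmf_of_set {1..K})"
  let ?S = "cost_support \<times> cost_support :: ((real ^ 'n) \<times> (real ^ 'n)) set"
  define \<pi> where "\<pi> = distr ?U (borel \<Otimes>\<^sub>M borel) (\<lambda>k. (C k, D k))"
  have S [measurable]: "?S \<in> sets (borel \<Otimes>\<^sub>M borel)" by measurable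
  have U: "k \<in> {1..K}" if "k \<in> set_pmf (pmf_of_set {1..K})" for k
    using that assms(1) by simp
  have "prob_space \<pi>"
    unfolding \<pi>_def
    by (rule prob_space.prob_space_distr)
       (auto intro: measure_pmf.prob_space_axioms simp: space_pair_measure)
  moreover have "emeasure \<pi> ?S = 1"
  proof -
    have "emeasure \<pi> ?S = emeasure ?U ((\<lambda>k. (C k, D k)) -` ?S)"
      using S by (simp add: \<pi>_def emeasure_distr space_pair_measure)
    also have "\<dots> = 1"
      using assms U by (intro measure_pmf.emeasure_eq_1_AE) (auto simp: AE_measure_pmf_iff)
    finally show ?thesis .
  qed
  moreover have "distr \<pi> borel fst = empirical_distribution K C"
    "distr \<pi> borel snd = empirical_distribution K D"
    by (auto simp: \<pi>_def distr_distr comp_def space_pair_measure empirical_distribution_eq_distr[OF assms(1)])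
  ultimately have "\<pi> \<in> couplings cost_support
      (empirical_distribution K C) (empirical_distribution K D)"
    by (simp add: couplings_def \<pi>_def)
  then have "wasserstein1 cost_support (empirical_distribution K C) (empirical_distribution K D)
      \<le> (\<integral>\<^sup>+p\<in>?S. ennreal (l1_norm (fst p - snd p)) \<partial>\<pi>)"
    unfolding wasserstein1_def by (rule INF_lower)
  also have "\<dots> \<le> (\<integral>\<^sup>+p. ennreal (l1_norm (fst p - snd p)) \<partial>\<pi>)"
    by (intro nn_integral_mono) (auto simp: indicator_def)
  also have "\<dots> = (\<integral>\<^sup>+k. ennreal (l1_norm (C k - D k)) \<partial>?U)"
    unfolding \<pi>_def by (subst nn_integral_distr) (auto simp: space_pair_measure)
  also have "\<dots> = ennreal (\<integral>k. l1_norm (C k - D k) \<partial>?U)"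
    using assms(1)
    by (intro nn_integral_eq_integral integrable_measure_pmf_finite)
       (auto simp: l1_norm_def sum_nonneg)
  also have "(\<integral>k. l1_norm (C k - D k) \<partial>?U) = (\<Sum>k\<in>{1..K}. l1_norm (C k - D k)) / real K"
    using assms(1) by (simp add: integral_pmf_of_set)
  finally show ?thesis .
qed

text \<open>The worst-case distribution moves every data point towards \<^term>\<open>1\<close> on the support of
  \<^term>\<open>x\<close>: each unit of transport cost spent there buys exactly one unit of loss.\<close>

lemma ambiguity_set_worst_case:
  fixes x :: "real ^ 'n"
  assumes x: "\<And>a. x $ a \<in> {0, 1}" and K: "K \<ge> 1" and \<epsilon>: "\<epsilon> \<ge> 0"
    and C: "\<And>k. k \<in> {1..K} \<Longrightarrow> C k \<in> cost_support"
  defines "m \<equiv> (\<Sum>k\<in>{1..K}. C k \<bullet> x) / real K"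
  shows "Q \<in> ambiguity_set K \<epsilon> C \<Longrightarrow> expected_loss x Q \<le> min (m + \<epsilon>) (l1_norm x)"
    and "\<exists>Q\<in>ambiguity_set K \<epsilon> C. expected_loss x Q = min (m + \<epsilon>) (l1_norm x)"
proof -
  assume Q: "Q \<in> ambiguity_set K \<epsilon> C"
  have "ennreal (expected_loss x Q - m) \<le> ennreal \<epsilon>"
    using expected_loss_diff_le_wasserstein1[OF x, of Q "empirical_distribution K C"] Q
    by (auto simp: ambiguity_set_def expected_loss_empirical[OF K] m_def)
  then have "expected_loss x Q \<le> m + \<epsilon>"
    using \<epsilon> by (simp add: ennreal_le_iff)
  moreover have "expected_loss x Q \<le> l1_norm x"
    using Q by (intro expected_loss_le_l1_norm x) (simp add: ambiguity_set_def)
  ultimately show "expected_loss x Q \<le> min (m + \<epsilon>) (l1_norm x)"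
    by simp
next
  have m_le: "m \<le> l1_norm x"
  proof -
    have "(\<Sum>k\<in>{1..K}. C k \<bullet> x) \<le> real (card {1..K}) * l1_norm x"
      using C by (intro sum_bounded_above cost_support_inner_bounds x)
    then show ?thesis
      using K by (simp add: m_def divide_simps mult.commute)
  qed
  \<comment> \<open>The fraction of the gap \<open>l1_norm x - m\<close> that the budget \<epsilon>
    can pay for, capped at the whole gap. For a zero gap, division by zero gives
    \<open>t = 0\<close>, and the identity for \<open>t\<close> below still holds.\<close>
  define t where "t = min 1 (\<epsilon> / (l1_norm x - m))"
  have t: "0 \<le> t" "t \<le> 1" "t * (l1_norm x - m) = min \<epsilon> (l1_norm x - m)"
    using m_le \<epsilon> by (auto simp: t_def min_def divide_simps)
  \<comment> \<open>Where \<open>x\<close> is 1, the entry moves the fraction \<open>t\<close> of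
    its way to 1; elsewhere it stays. Using the same \<open>t\<close> for all \<open>k\<close> makes
    the averages over \<open>k\<close> linear in \<open>m\<close>.\<close>
  define D where "D k = (\<chi> a. C k $ a + t * (x $ a * (1 - C k $ a)))" for k
  have D: "D k \<in> cost_support" if "k \<in> {1..K}" for k
  proof -
    have "0 \<le> D k $ a \<and> D k $ a \<le> 1" for a
    proof -
      have c: "0 \<le> C k $ a" "C k $ a \<le> 1"
        using C[OF that] by (auto simp: cost_support_def)
      have "0 \<le> t * (1 - C k $ a)" "t * (1 - C k $ a) \<le> 1 - C k $ a"
        using t c by (auto intro: mult_left_le_one_le)
      with c x[of a] show ?thesis
        by (auto simp: D_def)
    qed
    then show ?thesis by (simp add: cost_support_def)
  qed
  \<comment> \<open>The room left between the loss of \<open>C k\<close> and the largest loss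
    \<open>l1_norm x\<close>.\<close>
  have gain: "(\<Sum>a\<in>UNIV. x $ a * (1 - C k $ a)) = l1_norm x - C k \<bullet> x" for k
    by (simp add: l1_norm_binary[OF x] inner_vec_def algebra_simps sum_subtractf)
  have dist: "l1_norm (C k - D k) = t * (l1_norm x - C k \<bullet> x)" if "k \<in> {1..K}" for k
  proof -
    have "\<bar>(C k - D k) $ a\<bar> = t * (x $ a * (1 - C k $ a))" for a
    proof -
      have "0 \<le> x $ a * (1 - C k $ a)"
        using C[OF that] x[of a] by (auto simp: cost_support_def)
      then have "0 \<le> t * (x $ a * (1 - C k $ a))"
        using t by simp
      then show ?thesis
        by (simp only: D_def vector_minus_component vec_lambda_beta)
    qed
    then show ?thesis
      by (simp add: l1_norm_def gain[unfolded l1_norm_def, symmetric] sum_distrib_left)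
  qed
  have loss: "D k \<bullet> x = C k \<bullet> x + t * (l1_norm x - C k \<bullet> x)" for k
  proof -
    have "D k $ a * x $ a = C k $ a * x $ a + t * (x $ a * (1 - C k $ a))" for a
      using x[of a] by (auto simp: D_def)
    then have "D k \<bullet> x = C k \<bullet> x + t * (\<Sum>a\<in>UNIV. x $ a * (1 - C k $ a))"
      by (simp add: inner_vec_def sum.distrib sum_distrib_left)
    then show ?thesis by (simp only: gain)
  qed
  have total: "(\<Sum>k\<in>{1..K}. t * (l1_norm x - C k \<bullet> x)) / real K = t * (l1_norm x - m)"
    using K by (simp add: m_def sum_subtractf field_simps flip: sum_distrib_left)
  let ?Q = "empirical_distribution K D"
  have "wasserstein1 cost_support (empirical_distribution K C) ?Q
      \<le> ennreal (t * (l1_norm x - m))"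
    using wasserstein1_empirical_le[of K C D] K C D dist total by simp
  also have "\<dots> \<le> ennreal \<epsilon>"
    by (rule ennreal_leI) (simp add: t)
  finally have "?Q \<in> ambiguity_set K \<epsilon> C"
    using empirical_in_distributions_on[of K D] K D by (simp add: ambiguity_set_def)
  moreover have "expected_loss x ?Q = m + t * (l1_norm x - m)"
    unfolding total[symmetric]
    by (simp add: expected_loss_empirical[OF K] loss sum.distrib add_divide_distrib m_def)
  ultimately show "\<exists>Q\<in>ambiguity_set K \<epsilon> C. expected_loss x Q = min (m + \<epsilon>) (l1_norm x)"
    using t(3) by (intro bexI[of _ ?Q]) auto
qed

text \<open>The bound is attained inside the ambiguity set, so the real supremum is a maximum and
  can be read off.\<close>

lemma worst_case_expectation_eq:
  fixes x :: "real ^ 'n"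
  assumes "\<And>a. x $ a \<in> {0, 1}" "K \<ge> 1" "\<epsilon> \<ge> 0"
    and "\<And>k. k \<in> {1..K} \<Longrightarrow> C k \<in> cost_support"
  shows "worst_case_expectation K \<epsilon> x C
    = min ((\<Sum>k\<in>{1..K}. C k \<bullet> x) / real K + \<epsilon>) (l1_norm x)"
  unfolding worst_case_expectation_def
  using ambiguity_set_worst_case[OF assms] by (intro cSup_eq_maximum) force+

section \<open>Worst-case data for a fixed decision\<close>

lemma feasible_data_cost_support:
  assumes "C \<in> feasible_data K xobs S" "k \<in> {1..K}"
  shows "C k \<in> cost_support"
  using assms by (auto simp: feasible_data_def observation_set_def PiE_def Pi_def)

text \<open>By the closed form the value is monotone in the mean loss, and the data points are
  constrained independently. Maximising each loss over its own compact observation set therefore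
  maximises the value.\<close>

lemma worst_case_expectation_arg_max:
  fixes x :: "real ^ 'n"
  assumes x: "\<And>a. x $ a \<in> {0, 1}" and K: "K \<ge> 1" and \<epsilon>: "\<epsilon> \<ge> 0"
    and ne: "\<And>k. k \<in> {1..K} \<Longrightarrow> observation_set (xobs k) (S k) \<noteq> {}"
  obtains C where "C \<in> feasible_data K xobs S"
    "\<And>C'. C' \<in> feasible_data K xobs S
      \<Longrightarrow> worst_case_expectation K \<epsilon> x C' \<le> worst_case_expectation K \<epsilon> x C"
proof -
  have "\<exists>c\<in>observation_set (xobs k) (S k). \<forall>c'\<in>observation_set (xobs k) (S k). c' \<bullet> x \<le> c \<bullet> x"
    if "k \<in> {1..K}" for k
    by (intro continuous_attains_sup compact_observation_set ne that continuous_intros)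
  then obtain c where c: "\<And>k. k \<in> {1..K} \<Longrightarrow> c k \<in> observation_set (xobs k) (S k)"
    "\<And>k c'. k \<in> {1..K} \<Longrightarrow> c' \<in> observation_set (xobs k) (S k) \<Longrightarrow> c' \<bullet> x \<le> c k \<bullet> x"
    by metis
  show thesis
  proof
    \<comment> \<open>Feasible data are extensional functions, hence the restriction to
      \<open>{1..K}\<close>.\<close>
    show feas: "restrict c {1..K} \<in> feasible_data K xobs S"
      using c(1) by (auto simp: feasible_data_def)
    fix C' assume C': "C' \<in> feasible_data K xobs S"
    have "(\<Sum>k\<in>{1..K}. C' k \<bullet> x) \<le> (\<Sum>k\<in>{1..K}. restrict c {1..K} k \<bullet> x)"
      using C' c(2) by (intro sum_mono) (auto simp: feasible_data_def PiE_def Pi_def)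
    then have mean: "(\<Sum>k\<in>{1..K}. C' k \<bullet> x) / real K
        \<le> (\<Sum>k\<in>{1..K}. restrict c {1..K} k \<bullet> x) / real K"
      by (rule divide_right_mono) simp
    have eq: "worst_case_expectation K \<epsilon> x C
        = min ((\<Sum>k\<in>{1..K}. C k \<bullet> x) / real K + \<epsilon>) (l1_norm x)"
      if "C \<in> feasible_data K xobs S" for C
      by (rule worst_case_expectation_eq[OF x K \<epsilon> feasible_data_cost_support[OF that]])
    show "worst_case_expectation K \<epsilon> x C' \<le> worst_case_expectation K \<epsilon> x (restrict c {1..K})"
      unfolding eq[OF C'] eq[OF feas]
      using mean by (intro min.mono) auto
  qed
qed

section \<open>Non-overlapping binary decisions\<close>

text \<open>Two members with entry 1 at the same \<open>a\<close> would add up to 2 there.\<close>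

lemma non_overlapping_family_sum_le_one:
  fixes xt :: "'i \<Rightarrow> real ^ 'n"
  assumes I: "finite I" and bin: "\<And>v. v \<in> I \<Longrightarrow> xt v $ a \<in> {0, 1}"
    and no: "\<And>v v'. v \<in> I \<Longrightarrow> v' \<in> I \<Longrightarrow> v \<noteq> v' \<Longrightarrow> non_overlapping (xt v) (xt v')"
  shows "(\<Sum>v\<in>I. xt v $ a) \<le> 1"
proof (cases "\<exists>v\<in>I. xt v $ a = 1")
  case True
  then obtain v where v: "v \<in> I" "xt v $ a = 1" by blast
  have "xt w $ a = 0" if "w \<in> I - {v}" for w
    using no[of v w] bin[of w] v that by (auto simp: non_overlapping_def dest!: spec[of _ a])
  then show ?thesis
    using v I by (simp add: sum.remove)
next
  case False
  then have "xt v $ a = 0" if "v \<in> I" for v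
    using bin[OF that] that by auto
  then show ?thesis by simp
qed

text \<open>The overlaps count pairwise disjoint parts of the support of \<open>x\<close>.\<close>

lemma non_overlapping_family_inner_sum_le:
  fixes xt :: "'i \<Rightarrow> real ^ 'n"
  assumes "finite I" and "\<And>v a. v \<in> I \<Longrightarrow> xt v $ a \<in> {0, 1}"
    and "\<And>v v'. v \<in> I \<Longrightarrow> v' \<in> I \<Longrightarrow> v \<noteq> v' \<Longrightarrow> non_overlapping (xt v) (xt v')"
    and x: "\<And>a. x $ a \<in> {0, 1}"
  shows "(\<Sum>v\<in>I. xt v \<bullet> x) \<le> l1_norm x"
proof -
  have "(\<Sum>v\<in>I. xt v \<bullet> x) = (\<Sum>a\<in>UNIV. (\<Sum>v\<in>I. xt v $ a) * x $ a)"
    by (simp add: inner_vec_def sum.swap[of _ I] sum_distrib_right)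
  also have "\<dots> \<le> (\<Sum>a\<in>UNIV. x $ a)"
  proof (rule sum_mono)
    fix a
    have "(\<Sum>v\<in>I. xt v $ a) \<le> 1"
      by (rule non_overlapping_family_sum_le_one) (use assms in auto)
    then show "(\<Sum>v\<in>I. xt v $ a) * x $ a \<le> x $ a"
      using x[of a] by auto
  qed
  finally show ?thesis by (simp add: l1_norm_binary[OF x])
qed

text \<open>An entry 1 would give 1 + 1 = 2. For decisions of norm \<open>h \<ge> 1\<close> this
  rules out one decision carrying two indices.\<close>

lemma non_overlapping_self:
  assumes "\<And>a. x $ a \<in> {0, 1}" "non_overlapping x x"
  shows "l1_norm x = 0"
proof -
  have "x $ a = 0" for a
    using assms(1)[of a] assms(2) unfolding non_overlapping_def by (auto dest!: spec[of _ a])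
  then show ?thesis by (simp add: l1_norm_def)
qed

text \<open>Makes \<open>X\<close> finite, so that \<open>MIN\<close> over \<open>X\<close> is a
  genuine minimum.\<close>

lemma finite_binary_vectors: "finite {x :: real ^ 'n. \<forall>a. x $ a \<in> {0, 1}}"
proof -
  have "{x :: real ^ 'n. \<forall>a. x $ a \<in> {0, 1}} \<subseteq> vec_lambda ` (UNIV \<rightarrow>\<^sub>E {0, 1})"
  proof
    fix x :: "real ^ 'n" assume "x \<in> {x. \<forall>a. x $ a \<in> {0, 1}}"
    then have "vec_nth x \<in> UNIV \<rightarrow>\<^sub>E {0, 1}" by auto
    then show "x \<in> vec_lambda ` (UNIV \<rightarrow>\<^sub>E {0, 1})"
      by (intro image_eqI[of _ _ "vec_nth x"]) (auto simp: vec_nth_inverse)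
  qed
  then show ?thesis
    by (rule finite_subset) (simp add: finite_PiE)
qed

section \<open>The value and an optimal decision of the three-level problem\<close>

theorem theorem3:
  fixes X :: "(real ^ 'n) set"
    and h K V :: nat
    and xobs xt :: "nat \<Rightarrow> real ^ 'n"
    and S Sbar :: "nat \<Rightarrow> real"
    and N :: "nat \<Rightarrow> nat"
    and \<epsilon> :: real
  assumes "h \<ge> 1" and "K \<ge> 1" and "\<epsilon> > 0"
    and "\<And>x a. x \<in> X \<Longrightarrow> x $ a \<in> {0, 1}"
    and "\<And>x. x \<in> X \<Longrightarrow> l1_norm x = real h"
    and "\<And>k. k \<in> {1..K} \<Longrightarrow> xobs k \<in> X"
    and "\<And>k. k \<in> {1..K} \<Longrightarrow> S k \<ge> 0"
    and "\<And>k. k \<in> {1..K} \<Longrightarrow> observation_set (xobs k) (S k) \<noteq> {}"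
    and "\<And>v. v \<in> {1..V} \<Longrightarrow> xt v \<in> X"
    and "\<And>v v'. v \<in> {1..V} \<Longrightarrow> v' \<in> {1..V} \<Longrightarrow> v \<noteq> v' \<Longrightarrow> non_overlapping (xt v) (xt v')"
    and "\<And>k. k \<in> {1..K} \<Longrightarrow> \<exists>v\<in>{1..V}. xobs k = xt v"
    and "\<And>v. v \<in> {1..V} \<Longrightarrow> N v = card {k \<in> {1..K}. xobs k = xt v}"
    and "\<And>v. v \<in> {1..V} \<Longrightarrow> N v \<ge> 1"
    and "(\<Sum>v\<in>{1..V}. N v) = K"
    and "\<And>v. v \<in> {1..V} \<Longrightarrow>
           Sbar v = (1 / real (N v)) * (\<Sum>k\<in>{k \<in> {1..K}. xobs k = xt v}. S k)"
  shows
    "(\<forall>x\<in>X. \<forall>C\<in>feasible_data K xobs S.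
        \<exists>Q. is_arg_max (expected_loss x) (\<lambda>Q. Q \<in> ambiguity_set K \<epsilon> C) Q)
     \<and> (\<forall>x\<in>X. \<exists>C. is_arg_max (worst_case_expectation K \<epsilon> x)
        (\<lambda>C. C \<in> feasible_data K xobs S) C)
     \<and> (MIN x\<in>X. worst_case_data_value K \<epsilon> xobs S x) =
        min ((1 / real K) *
               (MIN v\<in>{1..V}. real (N v) * Sbar v + (real K - real (N v)) * real h) + \<epsilon>)
            (real h)
     \<and> (\<forall>v. is_arg_min (\<lambda>v. real (N v) * Sbar v + (real K - real (N v)) * real h)
               (\<lambda>v. v \<in> {1..V}) v
          \<longrightarrow> is_arg_min (worst_case_data_value K \<epsilon> xobs S) (\<lambda>x. x \<in> X) (xt v))"
proof -
  define \<phi> where "\<phi> = (\<lambda>v. real (N v) * Sbar v + (real K - real (N v)) * real h)"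
  note h = assms(1) and K = assms(2) and bin = assms(4) and norm = assms(5)
    and obs = assms(6) and S_nonneg = assms(7) and ne = assms(8) and xt = assms(9)
    and no = assms(10) and N = assms(12)
  have \<epsilon>: "\<epsilon> \<ge> 0" using assms(3) by simp
  let ?F = "feasible_data K xobs S"
  have wce: "worst_case_expectation K \<epsilon> x C
      = min ((\<Sum>k\<in>{1..K}. C k \<bullet> x) / real K + \<epsilon>) (real h)"
    if "x \<in> X" "C \<in> ?F" for x C
    using worst_case_expectation_eq[OF bin[OF that(1)] K \<epsilon> feasible_data_cost_support[OF that(2)]]
    by (simp add: norm[OF that(1)])
  \<comment> \<open>A maximising data set replaces the supremum: the upper bound evaluates the value
    there, and the lower bound compares it with other feasible data.\<close>
  have value_attained: "\<exists>C\<in>?F. (\<forall>C'\<in>?F.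
        worst_case_expectation K \<epsilon> x C' \<le> worst_case_expectation K \<epsilon> x C)
      \<and> worst_case_data_value K \<epsilon> xobs S x = worst_case_expectation K \<epsilon> x C"
    if x: "x \<in> X" for x
  proof -
    obtain C where "C \<in> ?F"
      "\<And>C'. C' \<in> ?F \<Longrightarrow> worst_case_expectation K \<epsilon> x C' \<le> worst_case_expectation K \<epsilon> x C"
      using worst_case_expectation_arg_max[OF bin[OF x] K \<epsilon>, of xobs S] ne by blast
    then show ?thesis
      unfolding worst_case_data_value_def by (intro bexI[of _ C] conjI cSup_eq_maximum) auto
  qed

  have V: "finite {1..V}" "{1..V} \<noteq> {}"
    using K assms(11)[of 1] by auto
  \<comment> \<open>\<open>g\<close> assigns to each observation the index of its decision. Since
    \<open>xt\<close> is injective on the indices, the fibres of \<open>g\<close> are the groups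
    counted by \<open>N\<close>.\<close>
  obtain g where g: "\<And>k. k \<in> {1..K} \<Longrightarrow> g k \<in> {1..V}" "\<And>k. k \<in> {1..K} \<Longrightarrow> xobs k = xt (g k)"
    using assms(11) by metis
  have xt_inj: "v = w" if "v \<in> {1..V}" "w \<in> {1..V}" "xt v = xt w" for v w
  proof (rule ccontr)
    assume "v \<noteq> w"
    then have "l1_norm (xt v) = 0"
      using no[of v w] that bin[OF xt[OF that(1)]] by (intro non_overlapping_self) auto
    then show False
      using h norm[OF xt[OF that(1)]] by simp
  qed
  have group: "{k \<in> {1..K}. g k = v} = {k \<in> {1..K}. xobs k = xt v}" if "v \<in> {1..V}" for v
    using g xt_inj that by metis
  have NS: "real (N v) * Sbar v = (\<Sum>k\<in>{k \<in> {1..K}. xobs k = xt v}. S k)"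
    if "v \<in> {1..V}" for v
    using assms(13)[OF that] assms(15)[OF that] by simp
  \<comment> \<open>Some vector of the cost box realises the observed cost, since the observation
    set is nonempty.\<close>
  have S_le: "S k \<le> real h" if k: "k \<in> {1..K}" for k
  proof -
    obtain c where c: "c \<in> cost_support" "c \<bullet> xobs k = S k"
      using ne[OF k] by (auto simp: observation_set_def)
    show ?thesis
      using cost_support_inner_bounds(2)[OF bin[OF obs[OF k]] c(1)] c(2) norm[OF obs[OF k]]
      by simp
  qed
  \<comment> \<open>Each observation of \<open>xt v\<close> saves \<open>h - S k\<close> against the
    maximal loss \<open>h\<close>; \<phi> is \<open>K h\<close> minus these savings.\<close>
  have \<phi>_eq: "\<phi> v = real K * real h - (\<Sum>k\<in>{k \<in> {1..K}. xobs k = xt v}. real h - S k)"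
    if "v \<in> {1..V}" for v
    using NS[OF that] N[OF that] by (simp add: \<phi>_def sum_subtractf algebra_simps)

  define m where "m = (MIN v\<in>{1..V}. \<phi> v)"
  have m_le: "m \<le> \<phi> v" if "v \<in> {1..V}" for v
    using that unfolding m_def by (intro Min_le) auto
  have m_le_Kh: "m \<le> real K * real h"
  proof -
    obtain v where v: "v \<in> {1..V}" using V by blast
    have "0 \<le> (\<Sum>k\<in>{k \<in> {1..K}. xobs k = xt v}. real h - S k)"
      using S_le by (intro sum_nonneg) auto
    then show ?thesis
      using m_le[OF v] \<phi>_eq[OF v] by linarith
  qed

  have upper: "worst_case_data_value K \<epsilon> xobs S (xt v) \<le> min (\<phi> v / real K + \<epsilon>) (real h)"
    if v: "v \<in> {1..V}" for v
  proof -
    obtain C where C: "C \<in> ?F"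
      "worst_case_data_value K \<epsilon> xobs S (xt v) = worst_case_expectation K \<epsilon> (xt v) C"
      using value_attained[OF xt[OF v]] by blast
    \<comment> \<open>An observation of \<open>xt v\<close> itself pins the loss to
      \<open>S k\<close>; any other one is bounded by \<open>h\<close> through the cost box
      alone.\<close>
    have "C k \<bullet> xt v \<le> real h - (if xobs k = xt v then real h - S k else 0)"
      if k: "k \<in> {1..K}" for k
    proof (cases "xobs k = xt v")
      case True
      then show ?thesis
        using C(1) k by (auto simp: feasible_data_def observation_set_def PiE_def Pi_def)
    next
      case False
      then show ?thesis
        using cost_support_inner_bounds(2)[OF bin[OF xt[OF v]] feasible_data_cost_support[OF C(1) k]]
          norm[OF xt[OF v]] by simp
    qed
    then have "(\<Sum>k\<in>{1..K}. C k \<bullet> xt v)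
        \<le> (\<Sum>k\<in>{1..K}. real h - (if xobs k = xt v then real h - S k else 0))"
      by (rule sum_mono)
    also have "\<dots> = \<phi> v"
      unfolding \<phi>_eq[OF v] sum.inter_filter[OF finite_atLeastAtMost]
      by (subst sum_subtractf) simp
    finally have "(\<Sum>k\<in>{1..K}. C k \<bullet> xt v) / real K \<le> \<phi> v / real K"
      by (rule divide_right_mono) simp
    then show ?thesis
      unfolding C(2) wce[OF xt[OF v] C(1)] by (intro min.mono) auto
  qed

  (* Its mean loss under x is 1 / K times an average of the values \<phi> v, weighted by the overlap
     of x with xt v, and of K h. *)
  define C0 where "C0 = (\<lambda>k\<in>{1..K}. 1 - (1 - S k / real h) *\<^sub>R xobs k)"
  have C0: "C0 \<in> ?F"
  proof -
    have "1 - (1 - S k / real h) *\<^sub>R xobs k \<in> observation_set (xobs k) (S k)"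
      if k: "k \<in> {1..K}" for k
    proof -
      have "0 \<le> S k / real h" "S k / real h \<le> 1"
        using S_nonneg[OF k] S_le[OF k] h by auto
      then have "0 \<le> (1 - (1 - S k / real h) *\<^sub>R xobs k) $ a
          \<and> (1 - (1 - S k / real h) *\<^sub>R xobs k) $ a \<le> 1" for a
        using bin[OF obs[OF k], of a] by auto
      \<comment> \<open>On the support of \<open>xobs k\<close> there are \<open>h\<close> entries,
        each equal to \<open>S k / h\<close>.\<close>
      moreover have "(1 - (1 - S k / real h) *\<^sub>R xobs k) \<bullet> xobs k = S k"
        using h by (simp add: inner_diff_left one_inner_binary[OF bin[OF obs[OF k]]]
            inner_binary_self[OF bin[OF obs[OF k]]] norm[OF obs[OF k]] field_simps)
      ultimately show ?thesis
        by (simp add: observation_set_def cost_support_def)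
    qed
    then show ?thesis
      by (auto simp: feasible_data_def C0_def)
  qed
  have lower: "min (m / real K + \<epsilon>) (real h) \<le> worst_case_data_value K \<epsilon> xobs S x"
    if x: "x \<in> X" for x
  proof -
    have overlap: "0 \<le> xt v \<bullet> x" if "v \<in> {1..V}" for v
      unfolding inner_vec_def inner_real_def
      by (intro sum_nonneg mult_nonneg_nonneg binary_nonneg_le_one bin x xt that)
    have "(\<Sum>v\<in>{1..V}. xt v \<bullet> x) \<le> l1_norm x"
      by (rule non_overlapping_family_inner_sum_le) (use bin xt no x in auto)
    then have overlap_sum: "(\<Sum>v\<in>{1..V}. xt v \<bullet> x / real h) \<le> 1"
      using h by (simp add: norm[OF x] flip: sum_divide_distrib)
    \<comment> \<open>The all-ones vector loses \<open>h\<close> under \<open>x\<close>;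
      \<open>C0 k\<close> falls short of it by the saving \<open>h - S k\<close>, scaled by the
      share of \<open>x\<close> that overlaps the observed decision.\<close>
    have "(\<Sum>k\<in>{1..K}. C0 k \<bullet> x)
        = (\<Sum>k\<in>{1..K}. real h - (xt (g k) \<bullet> x / real h) * (real h - S k))"
    proof (rule sum.cong)
      fix k assume k: "k \<in> {1..K}"
      then show "C0 k \<bullet> x = real h - (xt (g k) \<bullet> x / real h) * (real h - S k)"
        using h by (simp add: C0_def inner_diff_left one_inner_binary[OF bin[OF x]] norm[OF x]
            g(2)[OF k] field_simps)
    qed simp
    also have "\<dots> = real K * real h
        - (\<Sum>k\<in>{1..K}. (xt (g k) \<bullet> x / real h) * (real h - S k))"
      by (simp add: sum_subtractf[of "\<lambda>_. real h"])
    \<comment> \<open>Collecting observations by decision makes the overlap share a common factor,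
      and the savings of group \<open>v\<close> add up to \<open>K h - \<phi> v\<close>.\<close>
    also have "(\<Sum>k\<in>{1..K}. (xt (g k) \<bullet> x / real h) * (real h - S k))
        = (\<Sum>v\<in>{1..V}. \<Sum>k\<in>{k \<in> {1..K}. g k = v}. (xt (g k) \<bullet> x / real h) * (real h - S k))"
      by (rule sum.group[symmetric]) (use g in auto)
    also have "\<dots> = (\<Sum>v\<in>{1..V}. (xt v \<bullet> x / real h) * (real K * real h - \<phi> v))"
    proof (rule sum.cong)
      fix v assume v: "v \<in> {1..V}"
      have "(\<Sum>k\<in>{k \<in> {1..K}. g k = v}. (xt (g k) \<bullet> x / real h) * (real h - S k))
          = (xt v \<bullet> x / real h) * (\<Sum>k\<in>{k \<in> {1..K}. g k = v}. real h - S k)"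
        unfolding sum_distrib_left by (rule sum.cong) auto
      then show "(\<Sum>k\<in>{k \<in> {1..K}. g k = v}. (xt (g k) \<bullet> x / real h) * (real h - S k))
          = (xt v \<bullet> x / real h) * (real K * real h - \<phi> v)"
        unfolding group[OF v] \<phi>_eq[OF v] by simp
    qed simp
    finally have loss: "(\<Sum>k\<in>{1..K}. C0 k \<bullet> x)
        = real K * real h - (\<Sum>v\<in>{1..V}. (xt v \<bullet> x / real h) * (real K * real h - \<phi> v))" .
    \<comment> \<open>Every group saves at most \<open>K h - m\<close>. This is nonnegative, so
      weights of total at most 1 save no more than \<open>K h - m\<close> altogether.\<close>
    have "(\<Sum>v\<in>{1..V}. (xt v \<bullet> x / real h) * (real K * real h - \<phi> v))
        \<le> (\<Sum>v\<in>{1..V}. (xt v \<bullet> x / real h) * (real K * real h - m))"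
      using m_le overlap by (intro sum_mono mult_left_mono) auto
    also have "\<dots> \<le> 1 * (real K * real h - m)"
      unfolding sum_distrib_right[symmetric]
      using overlap_sum m_le_Kh by (intro mult_right_mono) auto
    finally have "m \<le> (\<Sum>k\<in>{1..K}. C0 k \<bullet> x)"
      unfolding loss by simp
    then have "m / real K \<le> (\<Sum>k\<in>{1..K}. C0 k \<bullet> x) / real K"
      by (rule divide_right_mono) simp
    then have "min (m / real K + \<epsilon>) (real h) \<le> worst_case_expectation K \<epsilon> x C0"
      unfolding wce[OF x C0] by (intro min.mono) auto
    also have "\<dots> \<le> worst_case_data_value K \<epsilon> xobs S x"
      using value_attained[OF x] C0 by auto
    finally show ?thesis .
  qed

  \<comment> \<open>At a minimiser of \<phi> the upper bound meets the lower bound that holds for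
    all decisions.\<close>
  have optimal: "worst_case_data_value K \<epsilon> xobs S (xt v) = min (m / real K + \<epsilon>) (real h)"
    if "v \<in> {1..V}" "\<phi> v = m" for v
    using upper[OF that(1)] lower[OF xt[OF that(1)]] unfolding that(2) by (rule antisym)
  have max_Q: "\<exists>Q. is_arg_max (expected_loss x) (\<lambda>Q. Q \<in> ambiguity_set K \<epsilon> C) Q"
    if x: "x \<in> X" and C: "C \<in> ?F" for x C
  proof -
    have C_supp: "C k \<in> cost_support" if "k \<in> {1..K}" for k
      using feasible_data_cost_support[OF C that] .
    note worst = ambiguity_set_worst_case[of x K \<epsilon> C, OF bin[OF x] K \<epsilon> C_supp]
    obtain Q where Q: "Q \<in> ambiguity_set K \<epsilon> C"
      "expected_loss x Q = min ((\<Sum>k\<in>{1..K}. C k \<bullet> x) / real K + \<epsilon>) (l1_norm x)"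
      using worst(2) by blast
    have "is_arg_max (expected_loss x) (\<lambda>Q. Q \<in> ambiguity_set K \<epsilon> C) Q"
      unfolding is_arg_max_linorder Q(2) using Q(1) worst(1) by blast
    then show ?thesis ..
  qed
  have max_C: "\<exists>C. is_arg_max (worst_case_expectation K \<epsilon> x) (\<lambda>C. C \<in> ?F) C" if "x \<in> X" for x
    using value_attained[OF that] unfolding is_arg_max_linorder by blast
  have min_value: "(MIN x\<in>X. worst_case_data_value K \<epsilon> xobs S x)
      = min ((1 / real K) * (MIN v\<in>{1..V}. \<phi> v) + \<epsilon>) (real h)"
  proof -
    have "finite X"
      using bin by (intro finite_subset[OF _ finite_binary_vectors]) auto
    have "m \<in> \<phi> ` {1..V}"
      using V unfolding m_def by (intro Min_in) auto
    then obtain v where v: "v \<in> {1..V}" "\<phi> v = m" by blast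
    have "(MIN x\<in>X. worst_case_data_value K \<epsilon> xobs S x) = min (m / real K + \<epsilon>) (real h)"
    proof (rule Min_eqI)
      show "min (m / real K + \<epsilon>) (real h) \<in> worst_case_data_value K \<epsilon> xobs S ` X"
        using optimal[OF v] xt[OF v(1)] by (metis imageI)
      show "min (m / real K + \<epsilon>) (real h) \<le> y"
        if "y \<in> worst_case_data_value K \<epsilon> xobs S ` X" for y
        using that lower by blast
    qed (use \<open>finite X\<close> in simp)
    then show ?thesis by (simp add: m_def)
  qed
  \<comment> \<open>Any minimiser of \<phi> has value \<open>m\<close>, so ties are covered as
    well.\<close>
  have arg_min: "is_arg_min (worst_case_data_value K \<epsilon> xobs S) (\<lambda>x. x \<in> X) (xt v)"
    if v: "is_arg_min \<phi> (\<lambda>v. v \<in> {1..V}) v" for v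
  proof -
    have "v \<in> {1..V}" and le: "\<And>w. w \<in> {1..V} \<Longrightarrow> \<phi> v \<le> \<phi> w"
      using v unfolding is_arg_min_linorder by auto
    then have "m = \<phi> v"
      unfolding m_def by (intro Min_eqI) auto
    then show ?thesis
      using optimal[OF \<open>v \<in> _\<close>] lower xt[OF \<open>v \<in> _\<close>] unfolding is_arg_min_linorder by simp
  qed
  show ?thesis
    using max_Q max_C min_value arg_min unfolding \<phi>_def by blast
qed

end
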